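(* Let $\Omega$, $B$, $\phi$, $\epsilon>0$, $D$ and $d$ be as in the context. Consider the bilinear form on $H^1_0(B)$ $$a(u,v) := \int_B \phi D\,\nabla u\cdot\nabla v + \frac{D}{\epsilon^{3}}(1-\phi)\,u v\;dx .$$ Then $a$ is symmetric, i.e. $a(u,v)=a(v,u)$ for all $u,v\in H^1_0(B)$, and coercive: there is a constant $C>0$ such that $$a(u,u)\ \ge\ C\,\|u\|^2\qquad\text{for all } u\in H^1_0(B),$$ where $\|\cdot\|$ is the following norm on $H^1_0(B)$: $$\|u\|^2 := \int_B \phi|\nabla u|^2+\epsilon^{-3}(1-\phi)|u|^2\;dx .$$
   Context: $\Omega\subset\mathbb{R}^n$ is a sufficiently smooth bounded domain, and $B\supset\Omega$ is a larger bounded domain. $r$ is the signed distance function of $\Omega$ (negative in $\Omega$, positive outside, $|\nabla r|=1$ almost everywhere). For a fixed parameter $\epsilon>0$ the phase-field function is $$\phi(x)=\tfrac12\left(1-\tanh\left(\tfrac{3r(x)}{\epsilon}\right)\right),\quad x\in B,$$ so $\phi$ takes values in $(0,1)$ and $\nabla\phi=-\frac{6}{\epsilon}\phi(1-\phi)\nabla r$. $D:B\to\mathbb{R}$ is a bounded scalar function with $D(x)\ge d>0$ for a constant $d$. *)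

theory Defs
  imports "HOL-Analysis.Analysis"
begin

section \<open>Smooth functions and domains\<close>

definition partial_deriv :: "'a::euclidean_space \<Rightarrow> ('a \<Rightarrow> real) \<Rightarrow> 'a \<Rightarrow> real" where
  "partial_deriv i f x = frechet_derivative f (at x) i"

fun C_k :: "nat \<Rightarrow> ('a::euclidean_space \<Rightarrow> real) \<Rightarrow> bool" where
  "C_k 0 f \<longleftrightarrow> continuous_on UNIV f"
| "C_k (Suc k) f \<longleftrightarrow> f differentiable_on UNIV \<and> (\<forall>i\<in>Basis. C_k k (partial_deriv i f))"

definition domain_set :: "'a::euclidean_space set \<Rightarrow> bool" where
  "domain_set S \<longleftrightarrow> open S \<and> connected S \<and> S \<noteq> {}"

text \<open>
  A boundary of class C^k: near each boundary point the set is, after a rigid motion, the region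
  above the graph of a C^k function of the first n - 1 coordinates. The unit vector e plays the
  role of the last coordinate direction; \<gamma> is evaluated only on the hyperplane orthogonal to e.
\<close>
definition C_k_boundary :: "nat \<Rightarrow> 'a::euclidean_space set \<Rightarrow> bool" where
  "C_k_boundary k S \<longleftrightarrow>
     (\<forall>p\<in>frontier S. \<exists>\<rho>>0. \<exists>e \<gamma>. norm e = 1 \<and> C_k k \<gamma> \<and>
        S \<inter> ball p \<rho> = {x \<in> ball p \<rho>. x \<bullet> e > \<gamma> (x - (x \<bullet> e) *\<^sub>R e)})"


section \<open>The Sobolev spaces \<open>H\<^sup>1\<close> and \<open>H\<^sup>1\<^sub>0\<close>\<close>

definition test_function :: "'a::euclidean_space set \<Rightarrow> ('a \<Rightarrow> real) \<Rightarrow> bool" where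
  "test_function B \<psi> \<longleftrightarrow>
     (\<forall>k. C_k k \<psi>) \<and> compact (closure {x. \<psi> x \<noteq> 0}) \<and> closure {x. \<psi> x \<noteq> 0} \<subseteq> B"

definition square_integrable ::
    "'a::euclidean_space set \<Rightarrow> ('a \<Rightarrow> 'b::euclidean_space) \<Rightarrow> bool" where
  "square_integrable B f \<longleftrightarrow>
     f \<in> borel_measurable (lebesgue_on B) \<and> integrable (lebesgue_on B) (\<lambda>x. (norm (f x))\<^sup>2)"

definition has_weak_gradient ::
    "'a::euclidean_space set \<Rightarrow> ('a \<Rightarrow> real) \<Rightarrow> ('a \<Rightarrow> 'a) \<Rightarrow> bool" where
  "has_weak_gradient B u g \<longleftrightarrow>
     (\<forall>\<psi>. test_function B \<psi> \<longrightarrow> (\<forall>i\<in>Basis.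
        (LINT x|lebesgue_on B. u x * partial_deriv i \<psi> x) =
        - (LINT x|lebesgue_on B. (g x \<bullet> i) * \<psi> x)))"

text \<open>
  Elements of the Sobolev spaces are represented by functions rather than by classes of
  functions modulo null sets; values outside B are irrelevant.
\<close>
definition H1 :: "'a::euclidean_space set \<Rightarrow> ('a \<Rightarrow> real) set" where
  "H1 B = {u. square_integrable B u \<and> (\<exists>g. square_integrable B g \<and> has_weak_gradient B u g)}"

text \<open>
  The weak gradient is unique only up to null sets; all uses below are under an integral over B.
\<close>
definition weak_grad :: "'a::euclidean_space set \<Rightarrow> ('a \<Rightarrow> real) \<Rightarrow> 'a \<Rightarrow> 'a" where
  "weak_grad B u = (SOME g. square_integrable B g \<and> has_weak_gradient B u g)"

definition H1_norm :: "'a::euclidean_space set \<Rightarrow> ('a \<Rightarrow> real) \<Rightarrow> real" where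
  "H1_norm B u = sqrt (LINT x|lebesgue_on B. (u x)\<^sup>2 + (norm (weak_grad B u x))\<^sup>2)"

definition H1_0 :: "'a::euclidean_space set \<Rightarrow> ('a \<Rightarrow> real) set" where
  "H1_0 B = {u \<in> H1 B. \<exists>\<psi>. (\<forall>k::nat. test_function B (\<psi> k)) \<and>
      (\<lambda>k. H1_norm B (\<lambda>x. u x - \<psi> k x)) \<longlonglongrightarrow> 0}"


section \<open>The phase field, the bilinear form and the weighted norm\<close>

definition signed_dist :: "'a::euclidean_space set \<Rightarrow> 'a \<Rightarrow> real" where
  "signed_dist \<Omega> x =
     (if x \<in> \<Omega> then - infdist x (frontier \<Omega>) else infdist x (frontier \<Omega>))"

definition phase_field :: "'a::euclidean_space set \<Rightarrow> real \<Rightarrow> 'a \<Rightarrow> real" where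
  "phase_field \<Omega> \<epsilon> x = 1 / 2 * (1 - tanh (3 * signed_dist \<Omega> x / \<epsilon>))"

definition a_form ::
    "'a::euclidean_space set \<Rightarrow> ('a \<Rightarrow> real) \<Rightarrow> ('a \<Rightarrow> real) \<Rightarrow> real \<Rightarrow>
     ('a \<Rightarrow> real) \<Rightarrow> ('a \<Rightarrow> real) \<Rightarrow> real" where
  "a_form B \<phi> D \<epsilon> u v =
     (LINT x|lebesgue_on B.
        \<phi> x * D x * (weak_grad B u x \<bullet> weak_grad B v x) +
        D x / \<epsilon> ^ 3 * (1 - \<phi> x) * u x * v x)"

definition phase_norm ::
    "'a::euclidean_space set \<Rightarrow> ('a \<Rightarrow> real) \<Rightarrow> real \<Rightarrow> ('a \<Rightarrow> real) \<Rightarrow> real" where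
  "phase_norm B \<phi> \<epsilon> u =
     sqrt (LINT x|lebesgue_on B.
        \<phi> x * (norm (weak_grad B u x))\<^sup>2 + 1 / \<epsilon> ^ 3 * (1 - \<phi> x) * \<bar>u x\<bar>\<^sup>2)"

end

theory Submission
  imports Defs
begin

text \<open>Symmetry holds pointwise under the integral. For coercivity, the integrand of a(u,u) is
  \<open>D\<close> times the integrand N of the squared norm. Since \<phi> lies in (0,1), N is
  nonnegative, so \<open>D x \<ge> d\<close> gives D N \<ge> d N pointwise, and integrating yields
  the constant C = d (\<open>a_form_coercive\<close>). The analytic content is integrability: the
  Bochner integral of a non-integrable function is 0, so the comparison needs D N to be integrable.
  This follows from square integrability of u and its weak gradient, since they are weighted by
  bounded measurable functions (\<open>integrable_weight_mult\<close>,
  \<open>borel_measurable_phase_field\<close>).\<close>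

lemma integrable_weight_mult:
  fixes w f :: "'a \<Rightarrow> real"
  assumes w: "w \<in> borel_measurable M" and f: "integrable M f"
    and bound: "\<And>x. x \<in> space M \<Longrightarrow> \<bar>w x\<bar> \<le> K"
  shows "integrable M (\<lambda>x. w x * f x)"
proof (rule Bochner_Integration.integrable_bound)
  show "integrable M (\<lambda>x. K * f x)"
    using f by simp
  show "(\<lambda>x. w x * f x) \<in> borel_measurable M"
    using w f by measurable
  show "AE x in M. norm (w x * f x) \<le> norm (K * f x)"
  proof (rule AE_I2)
    fix x assume "x \<in> space M"
    then have "\<bar>w x\<bar> \<le> \<bar>K\<bar>"
      using bound by fastforce
    then show "norm (w x * f x) \<le> norm (K * f x)"
      by (simp add: abs_mult mult_right_mono)
  qed
qed

text \<open>Each of the two branches is continuous and \<Omega> is a Borel set, so no continuity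
  across the frontier has to be shown.\<close>

lemma borel_measurable_signed_dist:
  assumes "open \<Omega>"
  shows "signed_dist \<Omega> \<in> borel_measurable borel"
proof -
  have "(\<lambda>x. infdist x (frontier \<Omega>)) \<in> borel_measurable borel"
    by (intro borel_measurable_continuous_onI continuous_on_infdist continuous_on_id)
  then have "(\<lambda>x. if x \<in> \<Omega> then - infdist x (frontier \<Omega>) else infdist x (frontier \<Omega>))
      \<in> borel_measurable borel"
    using assms by (intro measurable_If) auto
  then show ?thesis
    by (simp add: signed_dist_def[abs_def])
qed

lemma borel_measurable_phase_field:
  assumes "open \<Omega>"
  shows "phase_field \<Omega> \<epsilon> \<in> borel_measurable borel"
proof -
  have "(tanh :: real \<Rightarrow> real) \<in> borel_measurable borel"
    by (intro borel_measurable_continuous_onI continuous_on_tanh continuous_on_id) auto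
  then show ?thesis
    unfolding phase_field_def[abs_def]
    using borel_measurable_signed_dist[OF assms] by measurable
qed

lemma phase_field_bounds: "0 < phase_field \<Omega> \<epsilon> x" "phase_field \<Omega> \<epsilon> x < 1"
  using tanh_real_lt_1[of "3 * signed_dist \<Omega> x / \<epsilon>"]
    tanh_real_gt_neg1[of "3 * signed_dist \<Omega> x / \<epsilon>"]
  by (simp_all add: phase_field_def)

text \<open>Membership in \<open>H1\<close> supplies a witness, so the choice in
  \<open>weak_grad\<close> really picks a square integrable weak gradient.\<close>

lemma square_integrable_weak_grad:
  assumes "u \<in> H1 B"
  shows "square_integrable B (weak_grad B u)"
  using assms someI_ex[of "\<lambda>g. square_integrable B g \<and> has_weak_gradient B u g"]
  by (auto simp: H1_def weak_grad_def)

lemma a_form_commute: "a_form B \<phi> D \<epsilon> u v = a_form B \<phi> D \<epsilon> v u"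
  unfolding a_form_def by (simp add: inner_commute mult.commute mult.left_commute)

text \<open>Stated for any measurable weight with values in [0,1]; the tanh profile enters only
  through these two properties.\<close>

lemma a_form_coercive:
  fixes B :: "'a::euclidean_space set"
  assumes u: "u \<in> H1 B" and "\<epsilon> > 0"
    and \<phi>: "\<phi> \<in> borel_measurable (lebesgue_on B)" "\<And>x. x \<in> B \<Longrightarrow> 0 \<le> \<phi> x \<and> \<phi> x \<le> 1"
    and D: "D \<in> borel_measurable (lebesgue_on B)" "bounded (D ` B)"
    and "d \<ge> 0" and Dd: "\<And>x. x \<in> B \<Longrightarrow> D x \<ge> d"
  shows "d * (phase_norm B \<phi> \<epsilon> u)\<^sup>2 \<le> a_form B \<phi> D \<epsilon> u u"
proof -
  define G where "G x = (norm (weak_grad B u x))\<^sup>2" for x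
  define N where "N x = \<phi> x * G x + 1 / \<epsilon> ^ 3 * (1 - \<phi> x) * \<bar>u x\<bar>\<^sup>2" for x
  have space: "space (lebesgue_on B) = B"
    by simp
  obtain K where K: "\<And>x. x \<in> B \<Longrightarrow> \<bar>D x\<bar> \<le> K"
    using D(2) by (auto simp: bounded_iff)
  have G: "integrable (lebesgue_on B) G"
    using square_integrable_weak_grad[OF u] by (simp add: square_integrable_def G_def[abs_def])
  have U: "integrable (lebesgue_on B) (\<lambda>x. \<bar>u x\<bar>\<^sup>2)"
    using u by (simp add: H1_def square_integrable_def)
  \<comment> \<open>To be used with t = \<phi> and t = 1 - \<phi>, the weights of the gradient term
    and of the zero-order term.\<close>
  have *: "\<bar>D x * t\<bar> \<le> K" if "x \<in> B" "0 \<le> t" "t \<le> 1" for x t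
    using mult_mono[OF K[OF that(1)] that(3)] K[OF that(1)] that by (simp add: abs_mult)
  have "integrable (lebesgue_on B) (\<lambda>x. (D x * \<phi> x) * G x)"
    using * \<phi> D G by (intro integrable_weight_mult[where K = K]) auto
  moreover have "integrable (lebesgue_on B) (\<lambda>x. (D x * (1 - \<phi> x)) * \<bar>u x\<bar>\<^sup>2)"
    using * \<phi> D U by (intro integrable_weight_mult[where K = K]) auto
  ultimately have "integrable (lebesgue_on B)
      (\<lambda>x. (D x * \<phi> x) * G x + 1 / \<epsilon> ^ 3 * ((D x * (1 - \<phi> x)) * \<bar>u x\<bar>\<^sup>2))"
    by (intro Bochner_Integration.integrable_add integrable_mult_right)
  then have int: "integrable (lebesgue_on B) (\<lambda>x. D x * N x)"
    by (simp add: N_def algebra_simps diff_divide_distrib)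
  have N_nonneg: "0 \<le> N x" if "x \<in> B" for x
    using \<phi>(2)[OF that] \<open>\<epsilon> > 0\<close> by (simp add: N_def G_def)
  \<comment> \<open>Squaring cancels the root in \<open>phase_norm\<close> because the integral of N
    is nonnegative.\<close>
  have "d * (phase_norm B \<phi> \<epsilon> u)\<^sup>2 = d * (LINT x|lebesgue_on B. N x)"
    using Bochner_Integration.integral_nonneg[of "lebesgue_on B" N] N_nonneg
    by (simp add: phase_norm_def N_def[abs_def] G_def space)
  also have "\<dots> = (LINT x|lebesgue_on B. d * N x)"
    by simp
  also have "\<dots> \<le> (LINT x|lebesgue_on B. D x * N x)"
  \<comment> \<open>This form of monotonicity asks for integrability of the larger function D N and
    its nonnegativity: were d N not integrable, its integral would be 0 and the inequality would
    still hold.\<close>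
  proof (rule Bochner_Integration.integral_mono'[OF int])
    fix x assume "x \<in> space (lebesgue_on B)"
    then have "x \<in> B"
      by simp
    then show "d * N x \<le> D x * N x" "0 \<le> D x * N x"
      using Dd[of x] N_nonneg[of x] \<open>d \<ge> 0\<close> by (auto intro: mult_right_mono)
  qed
  also have "\<dots> = a_form B \<phi> D \<epsilon> u u"
    unfolding a_form_def N_def G_def
    by (simp add: dot_square_norm algebra_simps power2_eq_square)
  finally show ?thesis .
qed

theorem theorem2p5:
  fixes \<Omega> B :: "(real ^ 'n) set"
    and D \<phi> :: "real ^ 'n \<Rightarrow> real"
    and d \<epsilon> :: real
    and k :: nat
  assumes "domain_set \<Omega>" "bounded \<Omega>" "k \<ge> 1" "C_k_boundary k \<Omega>"
    and "domain_set B" "bounded B" "\<Omega> \<subset> B"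
    and "\<epsilon> > 0"
    and "\<phi> = phase_field \<Omega> \<epsilon>"
    and "D \<in> borel_measurable (lebesgue_on B)" "bounded (D ` B)"
    and "d > 0" "\<forall>x\<in>B. D x \<ge> d"
  shows "(\<forall>u\<in>H1_0 B. \<forall>v\<in>H1_0 B. a_form B \<phi> D \<epsilon> u v = a_form B \<phi> D \<epsilon> v u) \<and>
         (\<exists>C>0. \<forall>u\<in>H1_0 B. a_form B \<phi> D \<epsilon> u u \<ge> C * (phase_norm B \<phi> \<epsilon> u)\<^sup>2)"
proof (intro conjI ballI exI[of _ d])
  show "a_form B \<phi> D \<epsilon> u v = a_form B \<phi> D \<epsilon> v u" for u v
    by (rule a_form_commute)
  show "d > 0"
    by fact
  fix u assume "u \<in> H1_0 B"
  then have u: "u \<in> H1 B"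
    by (simp add: H1_0_def)
  have "open \<Omega>"
    using assms by (simp add: domain_set_def)
  \<comment> \<open>Borel measurability passes to the Lebesgue completion and then to the
    restriction to B.\<close>
  have "\<phi> \<in> borel_measurable (lebesgue_on B)"
    using borel_measurable_phase_field[OF \<open>open \<Omega>\<close>, of \<epsilon>] assms(9)
    by (simp add: measurable_completion measurable_restrict_space1)
  moreover have "0 \<le> \<phi> x \<and> \<phi> x \<le> 1" for x
    using phase_field_bounds[of \<Omega> \<epsilon> x] assms(9) by simp
  ultimately show "d * (phase_norm B \<phi> \<epsilon> u)\<^sup>2 \<le> a_form B \<phi> D \<epsilon> u u"
    using assms by (intro a_form_coercive[OF u]) auto
qed

end
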